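(* Let $S$ be a semigroup of unbounded exponent. Then $\omega(\Gamma(S))$ is countably infinite.
   Context: For a subset $X$ of a semigroup $S$, $\langle X\rangle$ denotes the subsemigroup generated by $X$; a semigroup is monogenic if it equals $\langle a\rangle=\{a^k : k\in\mathbb{N}\}$ for some element $a$, where $\mathbb{N}$ is the set of positive integers. The cyclic graph $\Gamma(S)$ is the simple undirected graph with vertex set $S$ in which two distinct vertices $x,y$ are adjacent if and only if $\langle x,y\rangle$ is a monogenic subsemigroup of $S$. A semigroup $S$ is of bounded exponent if there exists a positive integer $n$ such that for all $x\in S$, $x^n=f$ for some idempotent $f$ of $S$; $S$ is of unbounded exponent if it is not of bounded exponent. A clique of a graph $\mathcal{G}$ is a complete subgraph of $\mathcal{G}$ (one in which any two distinct vertices are adjacent), and the clique number $\omega(\mathcal{G})$ is the number of vertices in a clique of maximum size in $\mathcal{G}$.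
   Formalization: The clique number is taken as the least cardinal bounding the sizes of all cliques, not the size of a clique of maximum size: a maximum clique need not exist (cyclic groups of all prime orders joined by a zero). The two agree whenever one exists. *)

theory Defs
  imports "HOL-Library.Ramsey"
begin

unbundle cardinal_syntax

section \<open>Powers and subsemigroups\<close>

text \<open>
  A type of class \<open>semigroup_mult\<close> has no unit, so powers are only meaningful for exponents
  \<open>n > 0\<close>; the value at \<open>n = 0\<close> is junk.
\<close>

definition spow :: "'a::semigroup_mult \<Rightarrow> nat \<Rightarrow> 'a" where
  "spow x n = (((*) x) ^^ (n - 1)) x"

lemma spow_1: "spow x 1 = x"
  by (simp add: spow_def)

lemma spow_Suc: "n > 0 \<Longrightarrow> spow x (Suc n) = x * spow x n"
  by (cases n) (simp_all add: spow_def)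

lemma spow_eq_power: "n > 0 \<Longrightarrow> spow (x :: 'a::monoid_mult) n = x ^ n"
  by (induction n rule: nat_induct_non_zero) (simp_all add: spow_1[simplified] spow_Suc)

inductive_set subsemigroup_gen :: "'a::semigroup_mult set \<Rightarrow> 'a set" for X :: "'a set" where
  base: "x \<in> X \<Longrightarrow> x \<in> subsemigroup_gen X"
| mult: "x \<in> subsemigroup_gen X \<Longrightarrow> y \<in> subsemigroup_gen X \<Longrightarrow> x * y \<in> subsemigroup_gen X"

lemma spow_add: "m > 0 \<Longrightarrow> n > 0 \<Longrightarrow> spow x (m + n) = spow x m * spow x n"
  by (induction m rule: nat_induct_non_zero)
     (simp_all add: spow_1[simplified] spow_Suc mult.assoc)

lemma subsemigroup_gen_singleton: "subsemigroup_gen {a} = {spow a k | k. k > 0}"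
proof
  show "subsemigroup_gen {a} \<subseteq> {spow a k | k. k > 0}"
  proof
    fix x assume "x \<in> subsemigroup_gen {a}"
    then show "x \<in> {spow a k | k. k > 0}"
    proof induction
      case (base x)
      then show ?case using spow_1[of a] by (auto intro!: exI[of _ 1])
    next
      case (mult x y)
      then obtain k l where "x = spow a k" "k > 0" "y = spow a l" "l > 0" by blast
      then have "x * y = spow a (k + l)" "k + l > 0" by (simp_all add: spow_add)
      then show ?case by blast
    qed
  qed
  have "spow a k \<in> subsemigroup_gen {a}" if "k > 0" for k
    using that
    by (induction k rule: nat_induct_non_zero)
       (auto simp: spow_1[simplified] spow_Suc intro: subsemigroup_gen.intros)
  then show "{spow a k | k. k > 0} \<subseteq> subsemigroup_gen {a}" by blast
qed

definition monogenic :: "'a::semigroup_mult set \<Rightarrow> bool" where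
  "monogenic T \<longleftrightarrow> (\<exists>a. T = subsemigroup_gen {a})"

definition bounded_exponent :: "'a::semigroup_mult itself \<Rightarrow> bool" where
  "bounded_exponent _ \<longleftrightarrow>
     (\<exists>n>0. \<forall>x::'a. \<exists>f. f * f = f \<and> spow x n = f)"

abbreviation unbounded_exponent :: "'a::semigroup_mult itself \<Rightarrow> bool" where
  "unbounded_exponent S \<equiv> \<not> bounded_exponent S"

section \<open>The cyclic graph\<close>

text \<open>
  A simple graph is given by its vertex set and a set of two-element edges, as expected by
  \<open>clique\<close> from \<open>HOL-Library.Ramsey\<close>. The vertex set of the cyclic graph is \<open>UNIV\<close>.
\<close>

definition cyclic_graph_edges :: "'a::semigroup_mult set set" where
  "cyclic_graph_edges = {{x, y} | x y. x \<noteq> y \<and> monogenic (subsemigroup_gen {x, y})}"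

lemma cyclic_graph_adjacent:
  "{x, y} \<in> cyclic_graph_edges \<longleftrightarrow> x \<noteq> y \<and> monogenic (subsemigroup_gen {x, y})"
  by (auto simp: cyclic_graph_edges_def doubleton_eq_iff insert_commute)

section \<open>Clique number as a cardinal\<close>

text \<open>
  A graph may have finite cliques of every size but no infinite one (for example, the cyclic graph
  of a disjoint union of cyclic groups of all prime orders, made into a semigroup by adjoining a
  zero). Then no clique has maximum size, so the clique number is taken to be the supremum of the
  cardinalities of the cliques, i.e. the least cardinal bounding all of them. It is determined up to
  \<open>=o\<close>, and agrees with the size of a maximum clique whenever there is one. All
  cliques are subsets of the vertex type, so that cardinals on this type suffice; the bound is also
  least among cardinals on any other type.
\<close>

definition bounds_cliques :: "'a set \<Rightarrow> 'a set set \<Rightarrow> 'b rel \<Rightarrow> bool" where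
  "bounds_cliques V E \<kappa> \<longleftrightarrow> Card_order \<kappa> \<and> (\<forall>C. C \<subseteq> V \<and> clique C E \<longrightarrow> |C| \<le>o \<kappa>)"

definition clique_number :: "'a set \<Rightarrow> 'a set set \<Rightarrow> 'a rel" where
  "clique_number V E =
     (SOME \<kappa>. bounds_cliques V E \<kappa> \<and> (\<forall>\<kappa>' :: 'a rel. bounds_cliques V E \<kappa>' \<longrightarrow> \<kappa> \<le>o \<kappa>'))"

lemma bounds_cliques_vertices: "bounds_cliques V E |V|"
  unfolding bounds_cliques_def by (intro conjI card_of_Card_order allI impI card_of_mono1) blast

lemma clique_number_exists:
  fixes V :: "'a set"
  shows "\<exists>\<kappa> :: 'a rel. bounds_cliques V E \<kappa> \<and> (\<forall>\<kappa>' :: 'a rel. bounds_cliques V E \<kappa>' \<longrightarrow> \<kappa> \<le>o \<kappa>')"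
proof -
  define R :: "'a rel set" where "R = {\<kappa>. bounds_cliques V E \<kappa>}"
  have mem: "\<kappa> \<in> R \<longleftrightarrow> bounds_cliques V E \<kappa>" for \<kappa>
    unfolding R_def by (rule mem_Collect_eq)
  have "|V| \<in> R" unfolding mem by (rule bounds_cliques_vertices)
  then have ne: "R \<noteq> {}" by (metis empty_iff)
  have co: "\<forall>\<kappa>\<in>R. Card_order \<kappa>"
    unfolding mem bounds_cliques_def Ball_def by (intro allI impI) (erule conjunct1)
  from exists_minim_Card_order[OF ne co] show ?thesis
    unfolding Bex_def Ball_def mem .
qed

lemma clique_number_spec:
  fixes E :: "'a set set"
  shows "bounds_cliques V E (clique_number V E) \<and>
    (\<forall>\<kappa>' :: 'a rel. bounds_cliques V E \<kappa>' \<longrightarrow> clique_number V E \<le>o \<kappa>')"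
  unfolding clique_number_def by (rule someI_ex[OF clique_number_exists])

lemmas clique_number_bounds = clique_number_spec[THEN conjunct1]

lemmas clique_number_least_aux = clique_number_spec[THEN conjunct2, rule_format]

lemma clique_number_least:
  fixes V :: "'a set" and \<kappa>' :: "'b rel"
  assumes "bounds_cliques V E \<kappa>'"
  shows "clique_number V E \<le>o \<kappa>'"
proof -
  have co: "Card_order \<kappa>'" using assms by (simp add: bounds_cliques_def)
  have wo: "Well_order |V|" "Well_order \<kappa>'"
    using co card_of_well_order_on[of V] by (simp_all only: card_order_on_def Field_card_of)
  consider "|V| \<le>o \<kappa>'" | "\<kappa>' \<le>o |V|"
    using ordLeq_total[OF wo] by (rule disjE)
  then show ?thesis
  proof cases
    case 1
    show ?thesis
      by (rule ordLeq_transitive[OF clique_number_least_aux[OF bounds_cliques_vertices] 1])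
  next
    case 2
    have "|Field \<kappa>'| \<le>o |V|"
      by (rule ordIso_ordLeq_trans[OF card_of_Field_ordIso[OF co] 2])
    then obtain B where B: "B \<subseteq> V" "|Field \<kappa>'| =o |B|"
      unfolding internalize_card_of_ordLeq2[of "Field \<kappa>'" V] by auto
    have eq: "\<kappa>' =o |B|"
      by (rule ordIso_transitive[OF ordIso_symmetric[OF card_of_Field_ordIso[OF co]] B(2)])
    have "bounds_cliques V E |B|"
      using assms ordLeq_ordIso_trans[OF _ eq]
      by (auto simp: bounds_cliques_def card_of_Card_order)
    then show ?thesis
      by (rule ordLeq_ordIso_trans[OF clique_number_least_aux ordIso_symmetric[OF eq]])
  qed
qed

lemma clique_number_eq_maximum:
  assumes "C \<subseteq> V" "clique C E" and "\<And>D. D \<subseteq> V \<Longrightarrow> clique D E \<Longrightarrow> |D| \<le>o |C|"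
  shows "clique_number V E =o |C|"
proof -
  have "bounds_cliques V E |C|"
    unfolding bounds_cliques_def using assms(3) by (intro conjI card_of_Card_order) blast
  then have "clique_number V E \<le>o |C|" by (rule clique_number_least)
  moreover have "|C| \<le>o clique_number V E"
    using clique_number_bounds[of V E] assms(1,2) unfolding bounds_cliques_def by blast
  ultimately show ?thesis by (simp only: ordIso_iff_ordLeq)
qed

end

theory Submission
  imports Defs "HOL-Library.Countable_Set_Type"
begin

text \<open>
  Both bounds rest on comparing powers of single elements.

  The cliques have no common finite size bound: the elements \<open>x, x\<^sup>2, x\<^sup>4, x\<^sup>8, \<dots>\<close> always form a clique, because
  each is a power of every earlier one. If all cliques had at most \<open>N\<close> vertices, then two of the
  first \<open>N + 1\<close> members of this chain would coincide for every \<open>x\<close>, so that \<open>x\<close> would have index and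
  period at most \<open>2\<^sup>N\<close>; then \<open>x\<close> to the power \<open>(2\<^sup>N)!\<close> would be idempotent for every \<open>x\<close>, and the
  exponent would be bounded (\<open>bounded_exponent_if_cliques_bounded\<close>).

  Every clique \<open>C\<close> is countable (\<open>countable_clique\<close>). Divide \<open>C\<close> according to the pair \<open>(p, q)\<close> that
  gives the first repetition \<open>x\<^sup>p = x\<^sup>q\<close>, \<open>p < q\<close>, among the powers of \<open>x\<close>, with one further class for
  the elements without repetition. There are countably many classes.
  If \<open>x\<close> and \<open>y\<close> belong to \<open>(p, q)\<close> and \<open>\<langle>x, y\<rangle> = \<langle>a\<rangle>\<close>, then \<open>a\<close> is a product of powers of \<open>x\<close> and \<open>y\<close>,
  which commute, so \<open>a\<^sup>p = a\<^sup>q\<close> and \<open>\<langle>a\<rangle>\<close> has at most \<open>q - 1\<close> elements. But \<open>\<langle>x\<rangle>\<close> has as many, hence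
  \<open>\<langle>x\<rangle> = \<langle>a\<rangle>\<close> contains \<open>y\<close>: the class lies in the countable set \<open>\<langle>x\<rangle>\<close>.
  For the elements of infinite order, fix one such \<open>x\<close>. Each \<open>y\<close> in \<open>C\<close> satisfies \<open>y\<^sup>i = x\<^sup>j\<close> for some
  \<open>i, j\<close>, and \<open>(i, j)\<close> determines \<open>y\<close>, since inside an infinite monogenic semigroup roots are unique.
\<close>

section \<open>Powers\<close>

lemma spow_mult:
  assumes "m > 0" "n > 0"
  shows "spow (spow x m) n = spow x (m * n)"
  using assms(2)
proof (induction n rule: nat_induct_non_zero)
  case 1
  show ?case using spow_1[of "spow x m"] by simp
next
  case (Suc n)
  then show ?case using assms(1) spow_add[of m "m * n" x]
    by (simp add: spow_Suc)
qed

lemma spow_in_gen: "k > 0 \<Longrightarrow> spow x k \<in> subsemigroup_gen {x}"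
  by (auto simp: subsemigroup_gen_singleton)

lemma subsemigroup_gen_mono: "X \<subseteq> subsemigroup_gen Y \<Longrightarrow> subsemigroup_gen X \<subseteq> subsemigroup_gen Y"
proof
  fix z assume "X \<subseteq> subsemigroup_gen Y" "z \<in> subsemigroup_gen X"
  from this(2,1) show "z \<in> subsemigroup_gen Y"
    by induction (auto intro: subsemigroup_gen.mult)
qed

lemma spow_repeat_shift:
  assumes "spow x p = spow x q" "p > 0" "q > 0"
  shows "spow x (p + t) = spow x (q + t)"
  using assms by (cases "t = 0") (simp_all add: spow_add)

lemma spow_repeat_mult:
  assumes "spow x m = spow x (m + r)" "m > 0"
  shows "spow x (m + t + k * r) = spow x (m + t)"
proof (induction k)
  case (Suc k)
  have "spow x (m + (t + k * r)) = spow x (m + r + (t + k * r))"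
    using assms by (intro spow_repeat_shift) auto
  then show ?case using Suc by (simp add: algebra_simps)
qed simp

text \<open>
  The power \<open>x\<^sup>n\<close> lies in the periodic part because \<open>n \<ge> m\<close>, and there multiplying by \<open>x\<^sup>n\<close> changes
  nothing because \<open>n\<close> is a multiple of the period.
\<close>

lemma spow_idempotent:
  assumes "spow x m = spow x (m + r)" "m > 0" "m \<le> n" "r dvd n"
  shows "spow x n * spow x n = spow x n"
proof -
  obtain k where k: "n = k * r" using assms(4) by (metis dvd_def mult.commute)
  have "spow x n * spow x n = spow x (m + (n - m) + k * r)"
    using assms(2,3) spow_add[of n n x] by (cases "n = 0") (simp_all add: k)
  also have "\<dots> = spow x n"
    using spow_repeat_mult[OF assms(1,2), of "n - m" k] assms(3) by simp
  finally show ?thesis .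
qed

section \<open>Large cliques\<close>

text \<open>The chain \<open>x, x\<^sup>2, x\<^sup>4, \<dots>\<close> works uniformly for elements of large index, of large period and of
  infinite order: for a cyclic group of large prime order, for instance, it consists of generators.\<close>

lemma clique_powers_of_two: "clique ((\<lambda>i. spow x (2 ^ i)) ` A) cyclic_graph_edges"
proof -
  have mono: "monogenic (subsemigroup_gen {spow x (2 ^ i), spow x (2 ^ j)})" if "i \<le> j" for i j
  proof -
    let ?u = "spow x (2 ^ i)"
    have "spow x (2 ^ j) = spow ?u (2 ^ (j - i))"
      using that by (simp add: spow_mult power_add[symmetric])
    then have "{?u, spow x (2 ^ j)} \<subseteq> subsemigroup_gen {?u}"
      by (auto intro: subsemigroup_gen.base spow_in_gen)
    then have "subsemigroup_gen {?u, spow x (2 ^ j)} = subsemigroup_gen {?u}"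
      by (intro equalityI subsemigroup_gen_mono) (auto intro: subsemigroup_gen.base)
    then show ?thesis unfolding monogenic_def by blast
  qed
  have "monogenic (subsemigroup_gen {spow x (2 ^ i), spow x (2 ^ j)})" for i j
    using mono[of i j] mono[of j i] by (cases "i \<le> j") (simp_all add: insert_commute)
  then show ?thesis by (auto simp: clique_def cyclic_graph_adjacent)
qed

lemma bounded_exponent_if_cliques_bounded:
  assumes "\<And>C :: 'a set. finite C \<Longrightarrow> clique C cyclic_graph_edges \<Longrightarrow> card C \<le> N"
  shows "bounded_exponent TYPE('a::semigroup_mult)"
proof -
  let ?n = "fact (2 ^ N) :: nat"
  have "spow x ?n * spow x ?n = spow x ?n" for x :: 'a
  proof -
    have "card ((\<lambda>i. spow x (2 ^ i)) ` {..N}) < card {..N}"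
      using assms[OF _ clique_powers_of_two[of x "{..N}"]] by simp
    then have "\<not> inj_on (\<lambda>i. spow x (2 ^ i)) {..N}"
      using pigeonhole by blast
    then obtain i j where ij: "i < j" "j \<le> N" "spow x (2 ^ i) = spow x (2 ^ j)"
      unfolding inj_on_def by (metis atMost_iff linorder_neqE_nat)
    define r :: nat where "r = 2 ^ j - 2 ^ i"
    have "(2::nat) ^ i < 2 ^ j" "(2::nat) ^ j \<le> 2 ^ N" using ij by simp_all
    then have r: "2 ^ j = 2 ^ i + r" "r > 0" "r \<le> 2 ^ N" "(2::nat) ^ i \<le> 2 ^ N"
      unfolding r_def by linarith+
    have "(2::nat) ^ i \<le> ?n" using r(4) fact_ge_self order_trans by blast
    moreover have "r dvd ?n" using r(2,3) by (intro dvd_fact) auto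
    ultimately show ?thesis
      using spow_idempotent[of x "2 ^ i" r ?n] ij(3) r(1) by simp
  qed
  then show ?thesis
    unfolding bounded_exponent_def by (intro exI[of _ ?n]) simp
qed

section \<open>Cliques are countable\<close>

lemma countable_gen_singleton: "countable (subsemigroup_gen {x})"
proof -
  have "subsemigroup_gen {x} = spow x ` {k. k > 0}"
    by (auto simp: subsemigroup_gen_singleton)
  then show ?thesis by simp
qed

lemma clique_common_generator:
  assumes "clique C cyclic_graph_edges" "x \<in> C" "y \<in> C"
  obtains a where "subsemigroup_gen {x, y} = subsemigroup_gen {a}"
proof (cases "x = y")
  case True
  then show ?thesis using that[of x] by simp
next
  case False
  then show ?thesis
    using assms that by (auto simp: clique_def cyclic_graph_adjacent monogenic_def)
qed

text \<open>
  Raising to a fixed power is multiplicative on the commutative semigroup \<open>\<langle>a\<rangle>\<close>, so the solutions of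
  \<open>t\<^sup>p = t\<^sup>q\<close> in it form a subsemigroup.
\<close>

lemma generator_repeat:
  assumes gen: "subsemigroup_gen {x, y} = subsemigroup_gen {a}"
    and "p > 0" "q > 0" "spow x p = spow x q" "spow y p = spow y q"
  shows "spow a p = spow a q"
proof -
  have hom: "spow (s * t) n = spow s n * spow t n"
    if st: "s \<in> subsemigroup_gen {a}" "t \<in> subsemigroup_gen {a}" and n: "n > 0" for s t n
  proof -
    obtain k l where "s = spow a k" "k > 0" "t = spow a l" "l > 0"
      using st by (auto simp: subsemigroup_gen_singleton)
    then show ?thesis using n
      by (simp add: spow_add[symmetric] spow_mult add_mult_distrib)
  qed
  have "spow t p = spow t q" if "t \<in> subsemigroup_gen {x, y}" for t
    using that
  proof induction
    case (base t)
    then show ?case using assms by auto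
  next
    case (mult s t)
    then show ?case using assms(2,3) gen by (simp add: hom)
  qed
  moreover have "a \<in> subsemigroup_gen {x, y}"
    unfolding gen by (auto intro: subsemigroup_gen.base)
  ultimately show ?thesis by blast
qed

lemma gen_subset_if_repeat:
  assumes "spow a p = spow a q" "0 < p" "p < q"
  shows "subsemigroup_gen {a} \<subseteq> spow a ` {1..<q}"
proof -
  have "spow a k \<in> spow a ` {1..<q}" if "k > 0" for k
    using that
  proof (induction k rule: less_induct)
    case (less k)
    show ?case
    proof (cases "k < q")
      case True
      then show ?thesis using less.prems by auto
    next
      case False
      have "spow a (p + (k - q)) = spow a (q + (k - q))"
        using assms by (intro spow_repeat_shift) auto
      then have "spow a k = spow a (p + (k - q))" using False by simp
      moreover have "spow a (p + (k - q)) \<in> spow a ` {1..<q}"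
        using less.IH[of "p + (k - q)"] assms False by auto
      ultimately show ?thesis by simp
    qed
  qed
  then show ?thesis by (auto simp: subsemigroup_gen_singleton)
qed

text \<open>Here \<open>p\<close> is the index of \<open>x\<close> and \<open>q - p\<close> its period. Injectivity below \<open>q\<close> is the form of
  minimality that gives \<open>\<langle>x\<rangle>\<close> at least \<open>q - 1\<close> elements.\<close>

definition first_repeat :: "'a::semigroup_mult \<Rightarrow> nat \<Rightarrow> nat \<Rightarrow> bool" where
  "first_repeat x p q \<longleftrightarrow>
     0 < p \<and> p < q \<and> spow x p = spow x q \<and> inj_on (spow x) {1..<q}"

lemma first_repeat_exists:
  assumes "\<not> inj_on (spow x) {0<..}"
  shows "\<exists>p q. first_repeat x p q"
proof -
  define P where "P q \<longleftrightarrow> (\<exists>p. 0 < p \<and> p < q \<and> spow x p = spow x q)" for q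
  obtain m n where mn: "0 < m" "m < n" "spow x m = spow x n"
    using assms unfolding inj_on_def by (metis greaterThan_iff linorder_neqE_nat)
  then have "P n" unfolding P_def by blast
  then have "P (Least P)" by (rule LeastI)
  moreover have "inj_on (spow x) {1..<Least P}"
  proof (rule ccontr)
    assume "\<not> inj_on (spow x) {1..<Least P}"
    then obtain i j where "1 \<le> i" "i < j" "j < Least P" "spow x i = spow x j"
      unfolding inj_on_def by (metis atLeastLessThan_iff linorder_neqE_nat)
    then have "P j" unfolding P_def by (intro exI[of _ i]) auto
    then show False using \<open>j < Least P\<close> not_less_Least by blast
  qed
  ultimately show ?thesis unfolding P_def first_repeat_def by blast
qed

text \<open>The repetition \<open>a\<^sup>p = a\<^sup>q\<close> bounds the size of \<open>\<langle>a\<rangle>\<close> by that of its subset \<open>\<langle>x\<rangle>\<close>, so the two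
  are equal.\<close>

lemma adjacent_same_first_repeat:
  assumes "subsemigroup_gen {x, y} = subsemigroup_gen {a}"
    and x: "first_repeat x p q" and y: "first_repeat y p q"
  shows "y \<in> subsemigroup_gen {x}"
proof -
  have pq: "0 < p" "p < q" and inj: "inj_on (spow x) {1..<q}"
    using x by (simp_all add: first_repeat_def)
  have "spow a p = spow a q"
    using generator_repeat[OF assms(1)] x y by (simp add: first_repeat_def)
  then have a: "subsemigroup_gen {a} \<subseteq> spow a ` {1..<q}"
    using pq by (rule gen_subset_if_repeat)
  have xa: "spow x ` {1..<q} \<subseteq> subsemigroup_gen {a}"
  proof -
    have "subsemigroup_gen {x} \<subseteq> subsemigroup_gen {a}"
      unfolding assms(1)[symmetric]
      by (rule subsemigroup_gen_mono) (auto intro: subsemigroup_gen.base)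
    then show ?thesis using spow_in_gen[of _ x] by fastforce
  qed
  have "card (subsemigroup_gen {a}) \<le> card (spow a ` {1..<q})"
    using a by (intro card_mono) auto
  also have "\<dots> \<le> card {1..<q}" by (rule card_image_le) simp
  also have "\<dots> = card (spow x ` {1..<q})" using inj by (simp add: card_image)
  finally have "spow x ` {1..<q} = subsemigroup_gen {a}"
    using xa a by (intro card_seteq) (auto intro: finite_subset)
  moreover have "y \<in> subsemigroup_gen {a}"
    unfolding assms(1)[symmetric] by (auto intro: subsemigroup_gen.base)
  ultimately have "y \<in> spow x ` {1..<q}" by simp
  then show ?thesis by (auto intro: spow_in_gen)
qed

lemma countable_clique_first_repeat:
  assumes "clique C cyclic_graph_edges"
  shows "countable {y \<in> C. first_repeat y p q}"
proof (cases "\<exists>x\<in>C. first_repeat x p q")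
  case True
  then obtain x where x: "x \<in> C" "first_repeat x p q" by blast
  have "{y \<in> C. first_repeat y p q} \<subseteq> subsemigroup_gen {x}"
  proof
    fix y assume "y \<in> {y \<in> C. first_repeat y p q}"
    then have y: "y \<in> C" "first_repeat y p q" by auto
    obtain a where "subsemigroup_gen {x, y} = subsemigroup_gen {a}"
      using clique_common_generator[OF assms x(1) y(1)] .
    then show "y \<in> subsemigroup_gen {x}"
      using x(2) y(2) by (rule adjacent_same_first_repeat)
  qed
  then show ?thesis using countable_gen_singleton countable_subset by blast
next
  case False
  then have "{y \<in> C. first_repeat y p q} = {}" by blast
  then show ?thesis by (simp only: countable_empty)
qed

lemma clique_common_root:
  assumes "clique C cyclic_graph_edges" "x \<in> C" "y \<in> C"
  obtains a i j where "x = spow a i" "y = spow a j" "i > 0" "j > 0"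
proof -
  obtain a where a: "subsemigroup_gen {x, y} = subsemigroup_gen {a}"
    using clique_common_generator[OF assms] .
  have "x \<in> subsemigroup_gen {a}" "y \<in> subsemigroup_gen {a}"
    unfolding a[symmetric] by (auto intro: subsemigroup_gen.base)
  then show ?thesis using that by (auto simp: subsemigroup_gen_singleton)
qed

text \<open>A repetition \<open>a\<^sup>m = a\<^sup>n\<close> is inherited by every power of \<open>a\<close>.\<close>

lemma infinite_order_root:
  assumes "inj_on (spow (spow a k)) {0<..}" "k > 0"
  shows "inj_on (spow a) {0<..}"
proof (rule inj_onI)
  fix m n :: nat
  assume mn: "m \<in> {0<..}" "n \<in> {0<..}" "spow a m = spow a n"
  have "spow (spow a k) l = spow (spow a l) k" if "l > 0" for l
    using assms(2) that by (simp add: spow_mult mult.commute)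
  then have "spow (spow a k) m = spow (spow a k) n" using mn by simp
  then show "m = n" using assms(1) mn(1,2) by (simp add: inj_on_eq_iff)
qed

lemma countable_clique_infinite_order:
  assumes "clique C cyclic_graph_edges"
  shows "countable {y \<in> C. inj_on (spow y) {0<..}}" (is "countable ?D")
proof (cases "?D = {}")
  case False
  then obtain x where x: "x \<in> C" by blast
  \<comment> \<open>Every \<open>D i j\<close> turns out to have at most one element.\<close>
  define D where "D i j = {y \<in> ?D. i > 0 \<and> spow y i = spow x j}" for i j
  have "countable (D i j)" for i j
  proof -
    have "y = z" if yD: "y \<in> D i j" and zD: "z \<in> D i j" for y z
    proof -
      have y: "y \<in> C" "inj_on (spow y) {0<..}" and z: "z \<in> C"
        and i: "i > 0" and eq: "spow y i = spow z i"
        using yD zD by (auto simp: D_def)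
      obtain b k l where b: "y = spow b k" "z = spow b l" "k > 0" "l > 0"
        using clique_common_root[OF assms y(1) z] .
      have inj: "inj_on (spow b) {0<..}"
        using infinite_order_root y(2) b(1,3) by blast
      have "spow b (k * i) = spow b (l * i)"
        using eq b i by (simp add: spow_mult)
      then have "k * i = l * i"
        using inj_onD[OF inj, of "k * i" "l * i"] b i by simp
      then show ?thesis using b i by simp
    qed
    then have "D i j \<subseteq> {SOME y. y \<in> D i j}" by (metis singletonI someI subsetI)
    then show ?thesis by (rule countable_subset) simp
  qed
  then have "countable (\<Union>i. \<Union>j. D i j)" by simp
  moreover have "?D \<subseteq> (\<Union>i. \<Union>j. D i j)"
  proof
    fix y assume y: "y \<in> ?D"
    then obtain a i j where a: "x = spow a i" "y = spow a j" "i > 0" "j > 0"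
      using clique_common_root[OF assms x] by blast
    then have "spow y i = spow x j" by (simp add: spow_mult mult.commute)
    then show "y \<in> (\<Union>i. \<Union>j. D i j)" using y a(3) unfolding D_def by blast
  qed
  ultimately show ?thesis using countable_subset by blast
next
  case True
  then show ?thesis by (simp only: countable_empty)
qed

lemma countable_clique:
  assumes "clique C cyclic_graph_edges"
  shows "countable C"
proof (rule countable_subset)
  show "C \<subseteq> {y \<in> C. inj_on (spow y) {0<..}} \<union> (\<Union>p. \<Union>q. {y \<in> C. first_repeat y p q})"
    using first_repeat_exists by blast
  show "countable ({y \<in> C. inj_on (spow y) {0<..}} \<union> (\<Union>p. \<Union>q. {y \<in> C. first_repeat y p q}))"
    using countable_clique_first_repeat[OF assms] countable_clique_infinite_order[OF assms] by simp
qed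

section \<open>The clique number\<close>

text \<open>A cardinal below \<open>natLeq\<close> is a natural number, so a clique number below it is a uniform bound on
  the sizes of all cliques.\<close>

lemma finite_clique_number_bounds_card:
  assumes "clique_number (UNIV :: 'a::semigroup_mult set) cyclic_graph_edges <o natLeq"
    and "clique (C :: 'a set) cyclic_graph_edges"
  shows "finite C \<and> card C \<le> card (Field (clique_number (UNIV :: 'a set) cyclic_graph_edges))"
proof -
  let ?\<kappa> = "clique_number (UNIV :: 'a set) cyclic_graph_edges"
  have bounds: "Card_order ?\<kappa>" "|C| \<le>o ?\<kappa>"
    using clique_number_bounds[of "UNIV :: 'a set" cyclic_graph_edges] assms(2)
    unfolding bounds_cliques_def by blast+
  have eq: "|Field ?\<kappa>| =o ?\<kappa>" by (rule card_of_Field_ordIso[OF bounds(1)])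
  have fin: "finite (Field ?\<kappa>)"
    using ordIso_ordLess_trans[OF eq assms(1)] finite_iff_ordLess_natLeq by blast
  have "|C| \<le>o |Field ?\<kappa>|"
    using ordLeq_ordIso_trans[OF bounds(2) ordIso_symmetric[OF eq]] .
  then obtain f where "inj_on f C" "f ` C \<subseteq> Field ?\<kappa>"
    unfolding card_of_ordLeq[symmetric] by blast
  then show ?thesis using fin by (metis card_inj_on_le inj_on_finite)
qed

theorem theorem4p12:
  assumes "unbounded_exponent TYPE('a::semigroup_mult)"
  shows "clique_number (UNIV :: 'a set) cyclic_graph_edges =o natLeq"
proof -
  let ?\<kappa> = "clique_number (UNIV :: 'a set) cyclic_graph_edges"
  have "|C| \<le>o natLeq" if "clique C cyclic_graph_edges" for C :: "'a set"
    using countable_clique[OF that] unfolding countable_card_le_natLeq .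
  then have "bounds_cliques (UNIV :: 'a set) cyclic_graph_edges natLeq"
    unfolding bounds_cliques_def using natLeq_Card_order by blast
  then have upper: "?\<kappa> \<le>o natLeq" by (rule clique_number_least)
  have "\<not> ?\<kappa> <o natLeq"
    using finite_clique_number_bounds_card bounded_exponent_if_cliques_bounded assms by blast
  then show ?thesis using upper by (metis ordLeq_iff_ordLess_or_ordIso)
qed

end
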